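(* Let $k\ge 5$ and let $G$ be an outerplanar (finite simple) graph with maximum degree $\Delta\le k$. Then $\operatorname{col}(T(G))\le k+1$.
   Context: A graph is outerplanar if it has a planar drawing with every vertex on the boundary of the outer face. The total graph $T(G)$ has vertex set $V(G)\cup E(G)$, two elements adjacent iff they are adjacent or incident in $G$. The coloring number $\operatorname{col}(H)$ is the smallest integer $m$ such that some ordering of $V(H)$ has each vertex with at most $m-1$ neighbors among vertices of smaller index. *)

theory Defs
  imports "HOL-Analysis.Analysis"
begin

definition simple_graph :: "'a set \<Rightarrow> 'a set set \<Rightarrow> bool" where
  "simple_graph V E \<longleftrightarrow> (\<forall>e\<in>E. e \<subseteq> V \<and> card e = 2)"

definition degree :: "'a set set \<Rightarrow> 'a \<Rightarrow> nat" where
  "degree E v = card {e \<in> E. v \<in> e}"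

text \<open>Inserting 0 only fixes the value for the graph without vertices.\<close>

definition max_degree :: "'a set \<Rightarrow> 'a set set \<Rightarrow> nat" where
  "max_degree V E = Max (insert 0 (degree E ` V))"

text \<open>
  A drawing without crossings: distinct vertices are sent to distinct points of the plane, each
  edge to an arc joining its end vertices, an arc meets the vertex set only at its own ends, and
  two arcs meet only at the ends they share.
\<close>

definition plane_drawing ::
    "'a set \<Rightarrow> 'a set set \<Rightarrow> ('a \<Rightarrow> complex) \<Rightarrow> ('a set \<Rightarrow> real \<Rightarrow> complex) \<Rightarrow> bool" where
  "plane_drawing V E p g \<longleftrightarrow>
     inj_on p V \<and>
     (\<forall>e\<in>E. arc (g e) \<and> {pathstart (g e), pathfinish (g e)} = p ` e) \<and>
     (\<forall>e\<in>E. path_image (g e) \<inter> p ` V = p ` e) \<and>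
     (\<forall>e\<in>E. \<forall>f\<in>E. e \<noteq> f \<longrightarrow> path_image (g e) \<inter> path_image (g f) = p ` (e \<inter> f))"

definition drawn_points ::
    "'a set \<Rightarrow> 'a set set \<Rightarrow> ('a \<Rightarrow> complex) \<Rightarrow> ('a set \<Rightarrow> real \<Rightarrow> complex) \<Rightarrow> complex set" where
  "drawn_points V E p g = p ` V \<union> (\<Union>e\<in>E. path_image (g e))"

text \<open>
  For a finite graph the set of drawn points is compact, so its complement has exactly one
  unbounded component, the outer face, and \<^const>\<open>outside\<close> is that component.
\<close>

definition outerplanar :: "'a set \<Rightarrow> 'a set set \<Rightarrow> bool" where
  "outerplanar V E \<longleftrightarrow>
     (\<exists>p g. plane_drawing V E p g \<and>
        (\<forall>v\<in>V. p v \<in> frontier (outside (drawn_points V E p g))))"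

definition total_vertices :: "'a set \<Rightarrow> 'a set set \<Rightarrow> ('a + 'a set) set" where
  "total_vertices V E = V <+> E"

definition total_edges :: "'a set \<Rightarrow> 'a set set \<Rightarrow> ('a + 'a set) set set" where
  "total_edges V E =
     {{Inl u, Inl v} | u v. u \<in> V \<and> v \<in> V \<and> {u, v} \<in> E} \<union>
     {{Inr e, Inr f} | e f. e \<in> E \<and> f \<in> E \<and> e \<noteq> f \<and> e \<inter> f \<noteq> {}} \<union>
     {{Inl v, Inr e} | v e. v \<in> V \<and> e \<in> E \<and> v \<in> e}"

text \<open>
  Orderings of a finite vertex set are the duplicate-free lists enumerating it. ``At most
  \<open>m - 1\<close>'' is written \<open>< m\<close> to avoid truncated subtraction.
\<close>

definition coloring_number :: "'a set \<Rightarrow> 'a set set \<Rightarrow> nat" where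
  "coloring_number V E =
     (LEAST m. \<exists>xs. distinct xs \<and> set xs = V \<and>
        (\<forall>i<length xs. card {u \<in> set (take i xs). {u, xs ! i} \<in> E} < m))"

end

theory Submission
  imports Defs
begin

text \<open>
  Deleting a vertex \<open>u\<close> of degree at most 1, or a vertex \<open>u\<close> of degree 2 with a neighbour \<open>w\<close> of
  degree at most 4, allows induction: an order for the total graph of \<open>G - u\<close> is continued by the
  edges at \<open>u\<close>, with \<open>uw\<close> last, and then by \<open>u\<close> itself. The edge \<open>uw\<close> sees at most
  \<open>4 + 1 \<le> k\<close> earlier elements and \<open>u\<close> at most 4.

  It remains to see that an outerplanar graph of minimum degree at least 2 has such an edge. Of
  three arcs forming a theta curve one lies inside the other two, so an outerplanar drawing has no
  subdivision of \<open>K\<^sub>2\<^sub>,\<^sub>3\<close> and no cycle with two crossing chords. Hence an end block is spanned by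
  a cycle with noncrossing chords, on which a shortest chord that skips at least two vertices
  (or an edge of the cycle) cuts off the required edge.
\<close>

section \<open>Theta curves\<close>

definition joins :: "(real \<Rightarrow> complex) \<Rightarrow> complex \<Rightarrow> complex \<Rightarrow> bool" where
  "joins c a b \<longleftrightarrow> arc c \<and> pathstart c = a \<and> pathfinish c = b"

lemma joins_simps:
  assumes "joins c a b"
  shows "arc c" "simple_path c" "pathstart c = a" "pathfinish c = b" "a \<noteq> b"
    "a \<in> path_image c" "b \<in> path_image c" "compact (path_image c)" "closed (path_image c)"
  using assms arc_distinct_ends[of c] unfolding joins_def
  by (auto simp: arc_imp_simple_path compact_arc_image closed_arc_image)

lemma joins_reverse: "joins c a b \<Longrightarrow> joins (reversepath c) b a"
  by (auto simp: joins_def arc_reversepath)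

lemma joins_interior:
  assumes "joins c a b"
  shows "connected (path_image c - {a, b})" "path_image c - {a, b} \<noteq> {}"
  using connected_simple_path_endless[of c] nonempty_simple_path_endless[of c] joins_simps[OF assms]
  by auto

text \<open>An arc is connected and has more than one point, so each of its points is a limit point,
  and discarding the two ends does not affect that. This puts the ends of a chord in the closure of
  any region that contains its interior.\<close>

lemma joins_closure:
  assumes "joins c a b"
  shows "a \<in> closure (path_image c - {a, b})" "b \<in> closure (path_image c - {a, b})"
proof -
  note c = joins_simps[OF assms]
  have "x islimpt (path_image c - {a, b})" if "x \<in> path_image c" for x
  proof -
    have "x islimpt path_image c"
      using c that connected_arc_image[of c]
      by (intro connected_imp_perfect) (auto simp: is_singleton_def)
    moreover have "path_image c = {a, b} \<union> (path_image c - {a, b})"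
      using c by auto
    ultimately show ?thesis
      by (metis finite.emptyI finite.insertI islimpt_Un_finite)
  qed
  with c show "a \<in> closure (path_image c - {a, b})" "b \<in> closure (path_image c - {a, b})"
    by (auto simp: closure_def)
qed

text \<open>\<open>c1\<close> followed by the reverse of \<open>c2\<close> is a simple closed curve,
  to which the Jordan curve theorem applies.\<close>

lemma Jordan_joins:
  assumes "joins c1 a b" "joins c2 a b" "path_image c1 \<inter> path_image c2 = {a, b}"
  defines "K \<equiv> path_image c1 \<union> path_image c2"
  shows "open (inside K)" "connected (inside K)" "inside K \<noteq> {}" "open (outside K)"
    "connected (outside K)" "frontier (inside K) = K" "closure (inside K) = inside K \<union> K"
proof -
  note c1 = joins_simps[OF assms(1)] and c2 = joins_simps[OF assms(2)]
  let ?c = "c1 +++ reversepath c2"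
  have "simple_path ?c"
    using c1 c2 assms(3) by (intro simple_path_join_loop) (auto simp: arc_reversepath)
  moreover have "pathfinish ?c = pathstart ?c"
    using c1 c2 by simp
  moreover have "path_image ?c = K"
    using c1 c2 by (simp add: path_image_join K_def)
  ultimately show J: "open (inside K)" "connected (inside K)" "inside K \<noteq> {}" "open (outside K)"
    "connected (outside K)" "frontier (inside K) = K"
    using Jordan_inside_outside[of ?c] by auto
  then show "closure (inside K) = inside K \<union> K"
    by (metis closure_Un_frontier)
qed

lemma connected_inside_or_outside:
  assumes "connected X" "X \<inter> K = {}" "open (inside K)" "open (outside K)"
  shows "X \<subseteq> inside K \<or> X \<subseteq> outside K"
proof -
  have "X \<subseteq> inside K \<union> outside K"
    using assms(2) by auto
  then show ?thesis
    using connectedD[OF assms(1,3,4)] inside_Int_outside[of K] by blast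
qed

text \<open>
  If no arc lay inside the other two, the inside of \<open>c2 \<union> c3\<close> would be disjoint from \<open>c1\<close> and
  outside of both \<open>c1 \<union> c2\<close> and \<open>c1 \<union> c3\<close>. These two sets meet in the connected set \<open>c1\<close>, so by
  Janiszewski's theorem their union would not separate that region from infinity.
\<close>

lemma theta_inside:
  assumes "joins c1 a b" "joins c2 a b" "joins c3 a b"
    and "path_image c1 \<inter> path_image c2 = {a, b}" "path_image c1 \<inter> path_image c3 = {a, b}"
    and "path_image c2 \<inter> path_image c3 = {a, b}"
  shows "path_image c1 - {a, b} \<subseteq> inside (path_image c2 \<union> path_image c3) \<or>
         path_image c2 - {a, b} \<subseteq> inside (path_image c1 \<union> path_image c3) \<or>
         path_image c3 - {a, b} \<subseteq> inside (path_image c1 \<union> path_image c2)"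
proof (rule ccontr)
  note c1 = joins_simps[OF assms(1)] and c2 = joins_simps[OF assms(2)] and c3 = joins_simps[OF assms(3)]
  note J12 = Jordan_joins[OF assms(1,2,4)]
  note J13 = Jordan_joins[OF assms(1,3,5)]
  note J23 = Jordan_joins[OF assms(2,3,6)]
  let ?C1 = "path_image c1" and ?C2 = "path_image c2" and ?C3 = "path_image c3"
  assume neg: "\<not> ?thesis"
  \<comment> \<open>By connectedness, an open arc that is not inside the curve formed by the other
    two is outside of it.\<close>
  have o1: "?C1 - {a, b} \<subseteq> outside (?C2 \<union> ?C3)"
    using neg connected_inside_or_outside[OF joins_interior(1)[OF assms(1)] _ J23(1,4)] assms(4-6) by blast
  have o2: "?C2 - {a, b} \<subseteq> outside (?C1 \<union> ?C3)"
    using neg connected_inside_or_outside[OF joins_interior(1)[OF assms(2)] _ J13(1,4)] assms(4-6) by blast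
  have o3: "?C3 - {a, b} \<subseteq> outside (?C1 \<union> ?C2)"
    using neg connected_inside_or_outside[OF joins_interior(1)[OF assms(3)] _ J12(1,4)] assms(4-6) by blast
  define A where "A = inside (?C2 \<union> ?C3)"
  have clA: "?C2 \<union> ?C3 \<subseteq> closure A"
    using J23(7) by (auto simp: A_def)
  have "A \<inter> (?C1 - {a, b}) = {}"
    using o1 inside_Int_outside[of "?C2 \<union> ?C3"] unfolding A_def by blast
  moreover have A23: "A \<inter> (?C2 \<union> ?C3) = {}"
    by (simp add: A_def)
  ultimately have A1: "A \<inter> ?C1 = {}"
    using c2 by blast
  \<comment> \<open>\<open>c2\<close> and \<open>c3\<close> bound \<open>A\<close>, so an open set
    around a nonempty piece of them reaches into \<open>A\<close>.\<close>
  have meet: "A \<inter> U \<noteq> {}" if "open U" "X \<noteq> {}" "X \<subseteq> U" "X \<subseteq> ?C2 \<union> ?C3" for U X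
    using that clA open_Int_closure_eq_empty[of U A] by blast
  \<comment> \<open>\<open>A\<close> is connected and misses \<open>c1 \<union> c2\<close>, so it
    lies on one side. It is the outer side, because the open arc of \<open>c3\<close> is on the
    boundary of \<open>A\<close> and lies outside.\<close>
  have A12: "A \<subseteq> outside (?C1 \<union> ?C2)"
    using connected_inside_or_outside[OF J23(2) _ J12(1,4)] A1 A23 inside_Int_outside[of "?C1 \<union> ?C2"]
      meet[OF J12(4) joins_interior(2)[OF assms(3)] o3] unfolding A_def by blast
  have A13: "A \<subseteq> outside (?C1 \<union> ?C3)"
    using connected_inside_or_outside[OF J23(2) _ J13(1,4)] A1 A23 inside_Int_outside[of "?C1 \<union> ?C3"]
      meet[OF J13(4) joins_interior(2)[OF assms(2)] o2] unfolding A_def by blast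
  obtain x where x: "x \<in> A"
    using J23(3) unfolding A_def by blast
  let ?T = "(?C1 \<union> ?C2) \<union> (?C1 \<union> ?C3)"
  have "bounded ?T"
    using c1 c2 c3 by (simp add: compact_imp_bounded)
  then obtain y where y: "y \<in> outside ?T"
    using outside_bounded_nonempty by blast
  have xy: "connected_component (- K) x y" if "connected (outside K)" "A \<subseteq> outside K" "K \<subseteq> ?T" for K
    unfolding connected_component_def
    using that x y outside_mono[OF that(3)] outside_no_overlap[of K]
    by (intro exI[of _ "outside K"]) blast
  have "connected_component (- ?T) x y"
  proof (rule Janiszewski)
    show "compact (?C1 \<union> ?C2)" "closed (?C1 \<union> ?C3)"
      using c1 c2 c3 by auto
    have "(?C1 \<union> ?C2) \<inter> (?C1 \<union> ?C3) = ?C1"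
      unfolding Un_Int_distrib[symmetric] assms(6) using c1(6,7) by blast
    then show "connected ((?C1 \<union> ?C2) \<inter> (?C1 \<union> ?C3))"
      using c1 connected_arc_image by simp
    show "connected_component (- (?C1 \<union> ?C2)) x y"
      by (rule xy[OF J12(5) A12]) auto
    show "connected_component (- (?C1 \<union> ?C3)) x y"
      by (rule xy[OF J13(5) A13]) auto
  qed
  \<comment> \<open>Being in the component of \<open>y\<close>, the point \<open>x\<close> is
    outside \<open>?T\<close> and so outside the smaller set \<open>c2 \<union> c3\<close>, although
    it was chosen inside.\<close>
  then have "x \<in> outside ?T"
    using y outside_same_component connected_component_sym by blast
  then have "x \<in> outside (?C2 \<union> ?C3)"
    using outside_mono[of "?C2 \<union> ?C3" ?T] by blast
  then show False
    using x inside_Int_outside unfolding A_def by blast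
qed

section \<open>Paths in outerplanar drawings\<close>

fun path_edges :: "'a list \<Rightarrow> 'a set set" where
  "path_edges (x # y # xs) = insert {x, y} (path_edges (y # xs))"
| "path_edges _ = {}"

definition graph_path :: "'a set set \<Rightarrow> 'a list \<Rightarrow> bool" where
  "graph_path E xs \<longleftrightarrow> xs \<noteq> [] \<and> distinct xs \<and> path_edges xs \<subseteq> E"

lemma graph_path_Cons:
  "graph_path E (x # y # xs) \<longleftrightarrow> {x, y} \<in> E \<and> x \<noteq> y \<and> x \<notin> set xs \<and> graph_path E (y # xs)"
  by (auto simp: graph_path_def)

lemma graph_path_single [simp]: "graph_path E [x]"
  by (simp add: graph_path_def)

lemma path_edges_append: "path_edges (xs @ x # ys) = path_edges (xs @ [x]) \<union> path_edges (x # ys)"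
  by (induction xs rule: path_edges.induct) auto

lemma path_edges_snoc: "path_edges (xs @ [x, y]) = insert {x, y} (path_edges (xs @ [x]))"
  using path_edges_append[of xs x "[y]"] by auto

lemma path_edges_rev: "path_edges (rev xs) = path_edges xs"
proof (induction xs rule: path_edges.induct)
  case (1 x y xs)
  then show ?case
    using path_edges_snoc[of "rev xs" y x] by (simp add: insert_commute)
qed auto

lemma graph_path_rev: "graph_path E (rev xs) \<longleftrightarrow> graph_path E xs"
  by (simp add: graph_path_def path_edges_rev)

lemma path_edges_subset: "e \<in> path_edges xs \<Longrightarrow> e \<subseteq> set xs"
  by (induction xs rule: path_edges.induct) auto

lemma Union_path_edges: "length xs \<ge> 2 \<Longrightarrow> \<Union> (path_edges xs) = set xs"
proof (induction xs rule: path_edges.induct)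
  case (1 x y xs)
  then show ?case by (cases xs) auto
qed auto

text \<open>Only the first edge contains the head, and its other end is not the last vertex. This
  makes paths that share just their ends edge-disjoint as soon as one has an inner vertex.\<close>

lemma ends_notin_path_edges:
  assumes "distinct xs" "length xs \<ge> 3"
  shows "{hd xs, last xs} \<notin> path_edges xs"
proof -
  obtain x y z ys where "xs = x # y # z # ys"
    using assms(2) by (cases xs rule: path_edges.cases; simp; metis Suc_le_length_iff)
  then show ?thesis
    using assms(1) path_edges_subset[of "{x, last xs}" "y # z # ys"] by (auto simp: doubleton_eq_iff)
qed

text \<open>The drawing is a parameter, not an existential witness, so that subgraphs can keep the
  same \<open>p\<close> and \<open>g\<close>.\<close>

locale outer_drawing =
  fixes V :: "'a set" and E :: "'a set set" and p :: "'a \<Rightarrow> complex" and g :: "'a set \<Rightarrow> real \<Rightarrow> complex"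
  assumes simple: "simple_graph V E"
    and drawing: "plane_drawing V E p g"
    and outer: "\<And>v. v \<in> V \<Longrightarrow> p v \<in> frontier (outside (drawn_points V E p g))"
begin

definition path_drawing :: "'a list \<Rightarrow> complex set" where
  "path_drawing xs = (\<Union>e\<in>path_edges xs. path_image (g e))"

lemma inj_p: "inj_on p V"
  using drawing by (simp add: plane_drawing_def)

lemma edge_subset: "e \<in> E \<Longrightarrow> e \<subseteq> V"
  using simple by (simp add: simple_graph_def)

lemma edge_neq: "{x, y} \<in> E \<Longrightarrow> x \<noteq> y"
  using simple by (force simp: simple_graph_def)

text \<open>An edge is an unordered pair, so its arc may run either way; it is reversed if
  necessary.\<close>

lemma edge_arc:
  assumes "{x, y} \<in> E"
  obtains c where "joins c (p x) (p y)" "path_image c = path_image (g {x, y})"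
proof -
  have g: "arc (g {x, y})" "{pathstart (g {x, y}), pathfinish (g {x, y})} = {p x, p y}"
    using drawing assms unfolding plane_drawing_def by auto
  show ?thesis
  proof (cases "pathstart (g {x, y}) = p x \<and> pathfinish (g {x, y}) = p y")
    case True
    then show ?thesis using that[of "g {x, y}"] g by (auto simp: joins_def)
  next
    case False
    then have "joins (g {x, y}) (p y) (p x)"
      using g by (auto simp: joins_def doubleton_eq_iff)
    then show ?thesis using that[of "reversepath (g {x, y})"] by (auto dest: joins_reverse)
  qed
qed

lemma edge_inter: "e \<in> E \<Longrightarrow> f \<in> E \<Longrightarrow> e \<noteq> f \<Longrightarrow> path_image (g e) \<inter> path_image (g f) = p ` (e \<inter> f)"
  using drawing unfolding plane_drawing_def by blast

lemma edge_vertices: "e \<in> E \<Longrightarrow> v \<in> V \<Longrightarrow> p v \<in> path_image (g e) \<longleftrightarrow> v \<in> e"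
proof -
  assume e: "e \<in> E" "v \<in> V"
  then have "path_image (g e) \<inter> p ` V = p ` e"
    using drawing unfolding plane_drawing_def by blast
  then have "p v \<in> path_image (g e) \<longleftrightarrow> p v \<in> p ` e"
    using e by blast
  then show ?thesis
    using inj_on_image_mem_iff[OF inj_p _ edge_subset] e by blast
qed

lemma path_vertices_subset: "graph_path E xs \<Longrightarrow> length xs \<ge> 2 \<Longrightarrow> set xs \<subseteq> V"
  using Union_path_edges[of xs] edge_subset by (fastforce simp: graph_path_def)

text \<open>The bound on the length matters: \<open>path_drawing\<close> collects arcs of edges and
  is empty for a single vertex.\<close>

lemma path_drawing_vertices:
  assumes "graph_path E xs" "length xs \<ge> 2" "v \<in> V"
  shows "p v \<in> path_drawing xs \<longleftrightarrow> v \<in> set xs"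
  using assms edge_vertices Union_path_edges[of xs] unfolding path_drawing_def graph_path_def by blast

lemma path_drawing_inter:
  assumes "graph_path E xs" "graph_path E ys" "length xs \<ge> 2" "length ys \<ge> 2"
    and "path_edges xs \<inter> path_edges ys = {}"
  shows "path_drawing xs \<inter> path_drawing ys = p ` (set xs \<inter> set ys)"
proof
  show "path_drawing xs \<inter> path_drawing ys \<subseteq> p ` (set xs \<inter> set ys)"
  proof
    fix z assume "z \<in> path_drawing xs \<inter> path_drawing ys"
    then obtain e f where ef: "e \<in> path_edges xs" "f \<in> path_edges ys"
      "z \<in> path_image (g e) \<inter> path_image (g f)"
      unfolding path_drawing_def by blast
    then have "z \<in> p ` (e \<inter> f)"
      using edge_inter[of e f] assms unfolding graph_path_def by blast
    then show "z \<in> p ` (set xs \<inter> set ys)"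
      using ef path_edges_subset by blast
  qed
  show "p ` (set xs \<inter> set ys) \<subseteq> path_drawing xs \<inter> path_drawing ys"
    using assms path_drawing_vertices path_vertices_subset by blast
qed

text \<open>The arc of the first edge can be prepended to the rest: \<open>x\<close> lies on no
  later edge, so they meet only in \<open>p y\<close>.\<close>

lemma path_arc:
  assumes "graph_path E xs" "length xs \<ge> 2"
  shows "\<exists>c. joins c (p (hd xs)) (p (last xs)) \<and> path_image c = path_drawing xs"
  using assms
proof (induction xs rule: path_edges.induct)
  case (1 x y zs)
  have xy: "{x, y} \<in> E" and nx: "x \<notin> set (y # zs)" and P: "graph_path E (y # zs)"
    using 1(2) by (auto simp: graph_path_Cons)
  obtain e where e: "joins e (p x) (p y)" "path_image e = path_image (g {x, y})"
    using edge_arc[OF xy] .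
  show ?case
  proof (cases "zs = []")
    case True
    then show ?thesis using e by (auto simp: path_drawing_def)
  next
    case False
    then obtain c where c: "joins c (p y) (p (last zs))" "path_image c = path_drawing (y # zs)"
      using 1(1)[OF P] by (cases zs) auto
    have "path_image e \<inter> path_image c \<subseteq> {p y}"
    proof
      fix z assume z: "z \<in> path_image e \<inter> path_image c"
      then obtain f where f: "f \<in> path_edges (y # zs)" "z \<in> path_image (g f)"
        using c(2) by (auto simp: path_drawing_def)
      then have "f \<in> E" "x \<notin> f"
        using P path_edges_subset[of f "y # zs"] nx by (auto simp: graph_path_def)
      then have "path_image (g {x, y}) \<inter> path_image (g f) = p ` ({x, y} \<inter> f)"
        by (intro edge_inter xy) auto
      then show "z \<in> {p y}"
        using z f e(2) \<open>x \<notin> f\<close> by auto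
    qed
    then have "joins (e +++ c) (p x) (p (last zs))"
      using joins_simps[OF e(1)] joins_simps[OF c(1)] by (auto simp: joins_def intro!: arc_join)
    moreover have "path_image (e +++ c) = path_drawing (x # y # zs)"
      using joins_simps[OF e(1)] joins_simps[OF c(1)] c(2) e(2)
      by (simp add: path_image_join path_drawing_def)
    ultimately show ?thesis
      using False by auto
  qed
qed auto

text \<open>A smaller set has a larger outside, so each vertex stays in the closure of
  \<open>outside K\<close>, whereas \<open>inside K\<close> is open and disjoint from
  \<open>outside K\<close>.\<close>

lemma vertex_notin_inside:
  assumes "v \<in> V" "closed K" "K \<subseteq> drawn_points V E p g"
  shows "p v \<notin> inside K"
proof
  assume v: "p v \<in> inside K"
  have "p v \<in> closure (outside (drawn_points V E p g))"
    using outer[OF assms(1)] by (simp add: frontier_def)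
  then have "p v \<in> closure (outside K)"
    using closure_mono[OF outside_mono[OF assms(3)]] by blast
  then show False
    using v open_Int_closure_eq_empty[OF open_inside[OF assms(2)], of "outside K"]
      inside_Int_outside[of K] by blast
qed

lemma path_drawing_subset: "graph_path E xs \<Longrightarrow> path_drawing xs \<subseteq> drawn_points V E p g"
  by (auto simp: path_drawing_def graph_path_def drawn_points_def)

text \<open>The paths \<open>xs\<close> and \<open>ys\<close> have inner vertices, and no vertex is
  inside a drawn closed curve. Of the three alternatives of \<open>theta_inside\<close> only the one
  for \<open>zs\<close> is left; \<open>zs\<close> may be a single edge.\<close>

lemma theta_chord_inside:
  assumes "graph_path E xs" "graph_path E ys" "graph_path E zs"
    and "length xs \<ge> 3" "length ys \<ge> 3" "length zs \<ge> 2"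
    and "hd xs = x" "hd ys = x" "hd zs = x" "last xs = y" "last ys = y" "last zs = y"
    and "set xs \<inter> set ys = {x, y}" "set xs \<inter> set zs = {x, y}" "set ys \<inter> set zs = {x, y}"
  obtains a b c where "joins a (p x) (p y)" "joins b (p x) (p y)" "joins c (p x) (p y)"
    "path_image a = path_drawing xs" "path_image b = path_drawing ys" "path_image c = path_drawing zs"
    "path_drawing xs \<inter> path_drawing ys = {p x, p y}" "path_drawing xs \<inter> path_drawing zs = {p x, p y}"
    "path_drawing ys \<inter> path_drawing zs = {p x, p y}"
    "path_drawing zs - {p x, p y} \<subseteq> inside (path_drawing xs \<union> path_drawing ys)"
proof -
  have len: "length xs \<ge> 2" "length ys \<ge> 2"
    using assms(4,5) by auto
  \<comment> \<open>A common edge would have to be \<open>{x, y}\<close>, which is not on a path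
    from \<open>x\<close> to \<open>y\<close> with at least three vertices.\<close>
  have disj: "path_edges us \<inter> path_edges ws = {}"
    if "graph_path E us" "length us \<ge> 3" "hd us = x" "last us = y" "set us \<inter> set ws = {x, y}" for us ws
  proof -
    have False if e: "e \<in> path_edges us" "e \<in> path_edges ws" for e
    proof -
      have "e \<in> E" "e \<subseteq> {x, y}"
        using e path_edges_subset[of e us] path_edges_subset[of e ws] \<open>set us \<inter> set ws = {x, y}\<close> \<open>graph_path E us\<close>
        by (auto simp: graph_path_def)
      then have "card e = 2" "e \<subseteq> {x, y}"
        using simple by (auto simp: simple_graph_def)
      then have "e = {x, y}"
        using card_mono[of "{x, y}" e] card_seteq[of "{x, y}" e] by (auto simp: card_insert_if split: if_splits)
      then show False
        using ends_notin_path_edges[of us] e \<open>graph_path E us\<close> that(1)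
          \<open>length us \<ge> 3\<close> \<open>hd us = x\<close> \<open>last us = y\<close> by (auto simp: graph_path_def)
    qed
    then show ?thesis by blast
  qed
  obtain a where a: "joins a (p x) (p y)" "path_image a = path_drawing xs"
    using path_arc[OF assms(1)] assms len by auto
  obtain b where b: "joins b (p x) (p y)" "path_image b = path_drawing ys"
    using path_arc[OF assms(2)] assms len by auto
  obtain c where c: "joins c (p x) (p y)" "path_image c = path_drawing zs"
    using path_arc[OF assms(3)] assms len by auto
  have i: "path_drawing xs \<inter> path_drawing ys = {p x, p y}" "path_drawing xs \<inter> path_drawing zs = {p x, p y}"
    "path_drawing ys \<inter> path_drawing zs = {p x, p y}"
    using path_drawing_inter[OF assms(1,2) len disj] path_drawing_inter[OF assms(1,3) len(1) assms(6) disj]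
      path_drawing_inter[OF assms(2,3) len(2) assms(6) disj] assms by auto
  have no: "\<not> path_drawing us - {p x, p y} \<subseteq> inside (path_drawing ws \<union> path_drawing zs)"
    if us: "graph_path E us" "length us \<ge> 3" "hd us = x" "last us = y"
      and ws: "graph_path E ws" "closed (path_drawing ws)" for us ws
  proof -
    \<comment> \<open>The second vertex \<open>x2\<close> is an inner vertex and serves as the
      witness.\<close>
    obtain x1 x2 x3 ys' where eq: "us = x1 # x2 # x3 # ys'"
      using us(2) by (metis Suc_le_length_iff numeral_3_eq_3)
    have 2: "x2 \<in> V" "x \<in> V" "y \<in> V" "x2 \<noteq> x" "x2 \<noteq> y"
      using path_vertices_subset[OF us(1)] us eq by (auto simp: graph_path_def split: if_splits)
    then have "p x2 \<in> path_drawing us - {p x, p y}"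
      using path_drawing_vertices[OF us(1), of x2] eq inj_onD[OF inj_p, of x2] by auto
    moreover have "p x2 \<notin> inside (path_drawing ws \<union> path_drawing zs)"
      using 2 ws joins_simps(9)[OF c(1)] c(2) path_drawing_subset assms(3)
      by (intro vertex_notin_inside) auto
    ultimately show ?thesis by blast
  qed
  have "\<not> path_drawing xs - {p x, p y} \<subseteq> inside (path_drawing ys \<union> path_drawing zs)"
    "\<not> path_drawing ys - {p x, p y} \<subseteq> inside (path_drawing xs \<union> path_drawing zs)"
    using no[of xs ys] no[of ys xs] assms joins_simps(9)[OF a(1)] joins_simps(9)[OF b(1)] a(2) b(2) by auto
  then have "path_drawing zs - {p x, p y} \<subseteq> inside (path_drawing xs \<union> path_drawing ys)"
    using theta_inside[OF a(1) b(1) c(1)] a b c i by auto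
  with a b c i that show ?thesis by blast
qed

text \<open>This excludes subdivisions of \<open>K\<^sub>2\<^sub>,\<^sub>3\<close>: the third path,
  too, has an inner vertex, which would be inside the other two.\<close>

lemma no_theta:
  assumes "graph_path E (x # xs @ [y])" "graph_path E (x # ys @ [y])" "graph_path E (x # zs @ [y])"
    and "xs \<noteq> []" "ys \<noteq> []" "zs \<noteq> []"
    and "set xs \<inter> set ys = {}" "set xs \<inter> set zs = {}" "set ys \<inter> set zs = {}"
  shows False
proof -
  have 3: "length (x # us @ [y]) \<ge> 3" if "us \<noteq> []" for us
    using that by (cases us) auto
  have "set (x # us @ [y]) \<inter> set (x # ws @ [y]) = {x, y}" if "set us \<inter> set ws = {}"
    "graph_path E (x # us @ [y])" "graph_path E (x # ws @ [y])" for us ws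
    using that by (auto simp: graph_path_def)
  note i = this[OF assms(7,1,2)] this[OF assms(8,1,3)] this[OF assms(9,2,3)]
  obtain a b c where abc: "joins a (p x) (p y)" "joins b (p x) (p y)"
    "path_image a = path_drawing (x # xs @ [y])" "path_image b = path_drawing (x # ys @ [y])"
    "path_drawing (x # zs @ [y]) - {p x, p y} \<subseteq>
      inside (path_drawing (x # xs @ [y]) \<union> path_drawing (x # ys @ [y]))"
    by (rule theta_chord_inside[OF assms(1-3) 3[OF assms(4)] 3[OF assms(5)] _ _ _ _ _ _ _ i]) auto
  obtain z zs' where z: "zs = z # zs'"
    using assms(6) by (cases zs) auto
  have zV: "z \<in> V" "x \<in> V" "y \<in> V" "z \<noteq> x" "z \<noteq> y"
    using path_vertices_subset[OF assms(3)] assms(3) z by (auto simp: graph_path_def)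
  then have "p z \<in> path_drawing (x # zs @ [y]) - {p x, p y}"
    using path_drawing_vertices[OF assms(3), of z] z inj_onD[OF inj_p, of z] by auto
  moreover have "p z \<notin> inside (path_drawing (x # xs @ [y]) \<union> path_drawing (x # ys @ [y]))"
    using zV joins_simps(9)[OF abc(1)] joins_simps(9)[OF abc(2)] abc path_drawing_subset assms(1,2)
    by (intro vertex_notin_inside) auto
  ultimately show False
    using abc by blast
qed

text \<open>
  The arc of \<open>{a, c}\<close> cuts the inside of the cycle into two regions, the arc of \<open>{b, d}\<close> lies
  within one of them, so \<open>b\<close> or \<open>d\<close> is in the closure of a region that it does not bound.
\<close>

lemma no_crossing_chords:
  assumes A: "graph_path E as" "graph_path E as'" "length as \<ge> 3" "length as' \<ge> 3"
    "hd as = a" "hd as' = a" "last as = c" "last as' = c" "set as \<inter> set as' = {a, c}"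
    and B: "graph_path E bs" "graph_path E bs'" "length bs \<ge> 3" "length bs' \<ge> 3"
    "hd bs = b" "hd bs' = b" "last bs = d" "last bs' = d" "set bs \<inter> set bs' = {b, d}"
    and eq: "path_edges as \<union> path_edges as' = path_edges bs \<union> path_edges bs'"
    and ac: "{a, c} \<in> E" and bd: "{b, d} \<in> E"
    and b: "b \<in> set as - {a, c}" and d: "d \<in> set as' - {a, c}"
  shows False
proof -
  have in_set: "hd us \<in> set us" "last us \<in> set us" if "graph_path E us" for us
    using that by (auto simp: graph_path_def)
  have ch: "graph_path E [a, c]" "graph_path E [b, d]"
    using ac bd edge_neq by (auto simp: graph_path_def)
  have i: "set as \<inter> set [a, c] = {a, c}" "set as' \<inter> set [a, c] = {a, c}"
    "set bs \<inter> set [b, d] = {b, d}" "set bs' \<inter> set [b, d] = {b, d}"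
    using A B in_set[of as] in_set[of as'] in_set[of bs] in_set[of bs'] by auto
  obtain k k' e where K: "joins k (p a) (p c)" "joins k' (p a) (p c)" "joins e (p a) (p c)"
    "path_image k = path_drawing as" "path_image k' = path_drawing as'" "path_image e = path_drawing [a, c]"
    and Ki: "path_drawing as \<inter> path_drawing as' = {p a, p c}" "path_drawing as \<inter> path_drawing [a, c] = {p a, p c}"
    "path_drawing as' \<inter> path_drawing [a, c] = {p a, p c}"
    and e: "path_drawing [a, c] - {p a, p c} \<subseteq> inside (path_drawing as \<union> path_drawing as')"
    by (rule theta_chord_inside[OF A(1,2) ch(1) A(3,4) _ A(5,6) _ A(7,8) _ A(9) i(1,2)]) auto
  obtain f where L: "joins f (p b) (p d)" "path_image f = path_drawing [b, d]"
    and f: "path_drawing [b, d] - {p b, p d} \<subseteq> inside (path_drawing bs \<union> path_drawing bs')"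
    by (rule theta_chord_inside[OF B(1,2) ch(2) B(3,4) _ B(5,6) _ B(7,8) _ B(9) i(3,4)]) auto
  let ?K = "path_drawing as \<union> path_drawing as'"
  let ?I = "inside (path_drawing as \<union> path_drawing [a, c])"
  let ?I' = "inside (path_drawing as' \<union> path_drawing [a, c])"
  \<comment> \<open>By \<open>eq\<close> both decompositions trace the same closed curve.\<close>
  have "path_drawing bs \<union> path_drawing bs' = ?K"
    using eq unfolding path_drawing_def by blast
  then have f': "path_drawing [b, d] - {p b, p d} \<subseteq> inside ?K"
    using f by simp
  have ne: "path_image e \<inter> inside (path_image k \<union> path_image k') \<noteq> {}"
    using e joins_interior(2)[OF K(3)] K by auto
  \<comment> \<open>The chord \<open>{a, c}\<close> runs inside the cycle and divides its inside
    into the region along \<open>as\<close> and the region along \<open>as'\<close>.\<close>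
  have split: "?I \<inter> ?I' = {}" "?I \<union> ?I' \<union> (path_drawing [a, c] - {p a, p c}) = inside ?K"
    using split_inside_simple_closed_curve[of k "p a" "p c" k' e] ne K Ki joins_simps by metis+
  have VV: "a \<in> V" "b \<in> V" "c \<in> V" "d \<in> V"
    using ac bd edge_subset by auto
  have "path_drawing [b, d] \<inter> path_drawing [a, c] = p ` (set [b, d] \<inter> set [a, c])"
    using ch b by (intro path_drawing_inter) (auto simp: doubleton_eq_iff)
  then have "path_drawing [b, d] \<inter> path_drawing [a, c] = {}"
    using b d by auto
  then have sub: "path_drawing [b, d] - {p b, p d} \<subseteq> ?I \<union> ?I'"
    using f' split(2) by blast
  note J = Jordan_joins[OF K(1,3)] and J' = Jordan_joins[OF K(2,3)]
  have J1: "open ?I" "closure ?I = ?I \<union> (path_drawing as \<union> path_drawing [a, c])"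
    using J K Ki by auto
  have J2: "open ?I'" "closure ?I' = ?I' \<union> (path_drawing as' \<union> path_drawing [a, c])"
    using J' K Ki by auto
  have "connected (path_drawing [b, d] - {p b, p d})"
    using joins_interior(1)[OF L(1)] L by simp
  then have "path_drawing [b, d] - {p b, p d} \<subseteq> ?I \<or> path_drawing [b, d] - {p b, p d} \<subseteq> ?I'"
    using connectedD[OF _ J1(1) J2(1) _ sub] split(1) sub by blast
  \<comment> \<open>For each region the end of the chord is chosen that is not on its boundary:
    \<open>d\<close> is not on \<open>as\<close>, and \<open>b\<close> is not on
    \<open>as'\<close>.\<close>
  then have "p d \<in> closure ?I \<or> p b \<in> closure ?I'"
    using joins_closure[OF L(1)] L(2) closure_mono by (metis subsetD)
  moreover have "p d \<notin> ?I" "p b \<notin> ?I'"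
    using joins_simps(9)[OF K(1)] joins_simps(9)[OF K(2)] joins_simps(9)[OF K(3)] path_drawing_subset A(1,2) ch
    unfolding K(4-6) by (intro vertex_notin_inside VV closed_Un Un_least; simp)+
  moreover have "b \<notin> set as'" "d \<notin> set as"
    using b d A(9) by auto
  then have "p d \<notin> path_drawing as \<union> path_drawing [a, c]" "p b \<notin> path_drawing as' \<union> path_drawing [a, c]"
    using path_drawing_vertices[OF A(1)] path_drawing_vertices[OF A(2)] path_drawing_vertices[OF ch(1)]
      A(3,4) VV b d by auto
  ultimately show False
    using J1 J2 by blast
qed

end

section \<open>End blocks are Hamiltonian\<close>

lemma path_edges_join:
  assumes "xs \<noteq> []" "ys \<noteq> []"
  shows "path_edges (xs @ ys) = insert {last xs, hd ys} (path_edges xs \<union> path_edges ys)"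
  using assms
proof (induction xs rule: path_edges.induct)
  case ("2_2" v)
  then show ?case by (cases ys) auto
qed auto

lemma graph_path_append:
  assumes "xs \<noteq> []" "ys \<noteq> []"
  shows "graph_path E (xs @ ys) \<longleftrightarrow>
    graph_path E xs \<and> graph_path E ys \<and> set xs \<inter> set ys = {} \<and> {last xs, hd ys} \<in> E"
  using assms by (auto simp: graph_path_def path_edges_join)

lemma graph_path_nth:
  "graph_path E xs \<Longrightarrow> Suc i < length xs \<Longrightarrow> {xs ! i, xs ! Suc i} \<in> E"
proof (induction xs arbitrary: i rule: path_edges.induct)
  case (1 x y xs)
  then show ?case by (cases i) (auto simp: graph_path_Cons)
qed auto

text \<open>The bound on the length keeps a single edge traversed back and forth from counting as a
  cycle.\<close>

definition graph_cycle :: "'a set set \<Rightarrow> 'a list \<Rightarrow> bool" where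
  "graph_cycle E xs \<longleftrightarrow> graph_path E xs \<and> length xs \<ge> 3 \<and> {last xs, hd xs} \<in> E"

text \<open>Any vertex may serve as the first one; with \<open>graph_cycle_prefix\<close> this
  yields every segment of a cycle as a path.\<close>

lemma graph_cycle_rotate: "graph_cycle E (xs @ ys) \<Longrightarrow> graph_cycle E (ys @ xs)"
  by (cases "xs = [] \<or> ys = []") (auto simp: graph_cycle_def graph_path_append Int_commute)

lemma graph_cycle_rev: "graph_cycle E (rev xs) \<longleftrightarrow> graph_cycle E xs"
  by (auto simp: graph_cycle_def graph_path_rev hd_rev last_rev insert_commute)

lemma graph_cycle_prefix: "graph_cycle E (xs @ ys) \<Longrightarrow> xs \<noteq> [] \<Longrightarrow> graph_path E xs"
  by (cases "ys = []") (auto simp: graph_cycle_def graph_path_append)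

text \<open>A walk is turned into a path stopped at its first vertex in \<open>T\<close>. Going
  backwards along the walk, a vertex of \<open>T\<close> restarts the path, a vertex already on the
  path cuts it down to the part from there, and any other vertex is prepended.\<close>

lemma reachable_path:
  assumes "(\<lambda>x y. {x, y} \<in> E \<and> y \<in> A)\<^sup>*\<^sup>* u t" "u \<in> A" "t \<in> T"
  shows "\<exists>ys v. graph_path E (ys @ [v]) \<and> hd (ys @ [v]) = u \<and> v \<in> T \<and> set ys \<inter> T = {} \<and>
    set (ys @ [v]) \<subseteq> A"
  using assms
proof (induction rule: converse_rtranclp_induct)
  case base
  then show ?case by (intro exI[of _ "[]"] exI[of _ t]) auto
next
  case (step u w)
  show ?case
  proof (cases "u \<in> T")
    case True
    then show ?thesis using step by (intro exI[of _ "[]"] exI[of _ u]) auto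
  next
    case False
    from step obtain ys v where ys: "graph_path E (ys @ [v])" "hd (ys @ [v]) = w" "v \<in> T"
      "set ys \<inter> T = {}" "set (ys @ [v]) \<subseteq> A"
      by blast
    show ?thesis
    proof (cases "u \<in> set ys")
      case True
      then obtain as bs where "ys = as @ u # bs"
        by (meson split_list)
      moreover from this have "graph_path E ((u # bs) @ [v])"
        using ys(1) graph_path_append[of as "(u # bs) @ [v]"] by (cases "as = []") auto
      ultimately show ?thesis
        using ys by (intro exI[of _ "u # bs"] exI[of _ v]) auto
    next
      case out: False
      have "graph_path E ([u] @ (ys @ [v]))"
        using ys step.hyps(1) out False by (subst graph_path_append) auto
      then show ?thesis
        using ys step.prems False by (intro exI[of _ "u # ys"] exI[of _ v]) auto
    qed
  qed
qed

lemma degree_le: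
  assumes "finite N" "\<And>u. {v, u} \<in> E \<Longrightarrow> u \<in> N" "\<And>e. e \<in> E \<Longrightarrow> card e = 2"
  shows "degree E v \<le> card N"
proof -
  have "{e \<in> E. v \<in> e} \<subseteq> (\<lambda>u. {v, u}) ` N"
  proof
    fix e assume e: "e \<in> {e \<in> E. v \<in> e}"
    then have "card e = 2"
      using assms(3) by blast
    then obtain x y where "e = {x, y}"
      by (auto simp: card_2_iff)
    then obtain u where "e = {v, u}"
      using e by auto
    then show "e \<in> (\<lambda>u. {v, u}) ` N"
      using e assms(2) by blast
  qed
  then show ?thesis
    unfolding degree_def using assms(1) by (meson card_image_le card_mono finite_imageI le_trans)
qed

section \<open>Noncrossing chords on a cycle of positions\<close>

lemma drop_nth_split: "i < j \<Longrightarrow> j < length xs \<Longrightarrow> \<exists>ys. drop i xs = xs ! i # ys @ drop j xs"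
proof (intro exI)
  assume ij: "i < j" "j < length xs"
  have "drop (Suc i) xs = take (j - Suc i) (drop (Suc i) xs) @ drop (j - Suc i) (drop (Suc i) xs)"
    by (rule append_take_drop_id[symmetric])
  then show "drop i xs = xs ! i # take (j - Suc i) (drop (Suc i) xs) @ drop j xs"
    using ij Cons_nth_drop_Suc[of i xs] by simp
qed

text \<open>
  Take a shortest chord \<open>(i, j)\<close> with \<open>i + 3 \<le> j\<close>. All chords strictly below it have length 2 and
  do not overlap.
\<close>

lemma noncrossing_chords_light:
  fixes D :: "nat \<Rightarrow> nat \<Rightarrow> bool"
  assumes "n \<ge> 3" and sym: "\<And>s t. D s t \<Longrightarrow> D t s" and irr: "\<And>s. \<not> D s s"
    and step: "\<And>s. Suc s < n \<Longrightarrow> D s (Suc s)" and wrap: "D 0 (n - 1)"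
    and cross: "\<And>i j k l. i < j \<Longrightarrow> j < k \<Longrightarrow> k < l \<Longrightarrow> l < n \<Longrightarrow> D i k \<Longrightarrow> D j l \<Longrightarrow> False"
  obtains t t' where "0 < t" "t < n" "0 < t'" "t' < n" "D t t'"
    "card {s. s < n \<and> D t s} \<le> 2" "card {s. s < n \<and> D t' s} \<le> 4"
\<comment> \<open>A triangle has no pair with \<open>i + 3 \<le> j\<close> and is treated
  directly.\<close>
proof (cases "n = 3")
  case True
  have "{s. s < n \<and> D 1 s} \<subseteq> {0, 2}" "{s. s < n \<and> D 2 s} \<subseteq> {0, 1}"
    using irr True by (auto simp: less_Suc_eq numeral_3_eq_3 numeral_2_eq_2)
  then have "card {s. s < n \<and> D 1 s} \<le> 2" "card {s. s < n \<and> D 2 s} \<le> 2"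
    using card_mono[of "{0, 2}" "{s. s < n \<and> D 1 s}"] card_mono[of "{0, 1}" "{s. s < n \<and> D 2 s}"] by simp_all
  then show ?thesis
    using that[of 1 2] step[of 1] True by (simp add: numeral_2_eq_2)
next
  case False
  \<comment> \<open>The closing edge \<open>(0, n - 1)\<close> qualifies for
    \<open>n \<ge> 4\<close>. Such a pair leaves at least two positions strictly between, all of
    them different from 0.\<close>
  define P where "P = (\<lambda>(i, j). i + 3 \<le> j \<and> j < n \<and> D i j)"
  have "P (0, n - 1)"
    using False assms(1) wrap by (auto simp: P_def)
  then obtain i j where ij: "P (i, j)" and least: "\<And>i' j'. P (i', j') \<Longrightarrow> j - i \<le> j' - i'"
    using ex_has_least_nat[of P "(0, n - 1)" "\<lambda>(i, j). j - i"] by auto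
  have ij': "i + 3 \<le> j" "j < n" "D i j"
    using ij by (auto simp: P_def)
  \<comment> \<open>A neighbour outside the range from \<open>i\<close> to \<open>j\<close> would
    give a crossing, and one at distance three or more a shorter pair satisfying
    \<open>P\<close>.\<close>
  have nb: "i \<le> s \<and> s \<le> j \<and> s \<le> t + 2 \<and> t \<le> s + 2 \<and> s \<noteq> t" if t: "i < t" "t < j" "s < n" "D t s" for s t
  proof -
    have "i \<le> s"
      using cross[of s i t j] t ij' sym by force
    moreover have "s \<le> j"
      using cross[of i t j s] t ij' sym by force
    moreover have "s \<le> t + 2"
      using least[of t s] t \<open>s \<le> j\<close> by (force simp: P_def)
    moreover have "t \<le> s + 2"
    proof (rule ccontr)
      assume "\<not> t \<le> s + 2"
      then have "P (s, t)"
        using t sym[OF t(4)] ij' by (simp add: P_def)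
      then show False
        using least[of s t] t \<open>i \<le> s\<close> by linarith
    qed
    ultimately show ?thesis
      using irr t by blast
  qed
  have four: "card {s. s < n \<and> D t s} \<le> 4" if "i < t" "t < j" for t
  proof -
    have "{s. s < n \<and> D t s} \<subseteq> {t - 2, t - 1, t + 1, t + 2}"
      using nb[OF that] by force
    then have "card {s. s < n \<and> D t s} \<le> card {t - 2, t - 1, t + 1, t + 2}"
      by (intro card_mono) auto
    also have "\<dots> \<le> 4"
      by (simp add: card_insert_if)
    finally show ?thesis .
  qed
  have two: "card {s. s < n \<and> D t s} \<le> 2" if "{s. s < n \<and> D t s} \<subseteq> {t - 1, t + 1}" for t
    using card_mono[OF _ that] by (simp add: card_insert_if split: if_splits)
  show ?thesis
  proof (cases "\<exists>a. i \<le> a \<and> a + 2 \<le> j \<and> D a (a + 2)")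
    case True
    then obtain a where a: "i \<le> a" "a + 2 \<le> j" "D a (a + 2)" by blast
    \<comment> \<open>The chord from \<open>a\<close> to \<open>a + 2\<close> shields
      \<open>a + 1\<close>: a neighbour at distance two would cross it.\<close>
    have "s = a \<or> s = a + 2" if "s < n" "D (a + 1) s" for s
    proof -
      have "i \<le> s" "s \<le> j" "s \<le> a + 3" "a \<le> s + 1" "s \<noteq> a + 1"
        using nb[of "a + 1" s] that a by auto
      moreover have "s \<noteq> a + 3"
        using cross[of a "a + 1" "a + 2" s] that a by auto
      moreover have "a \<noteq> s + 1"
        using cross[of s a "a + 1" "a + 2"] that a ij' sym by auto
      ultimately show ?thesis by linarith
    qed
    then have 2: "card {s. s < n \<and> D (a + 1) s} \<le> 2"
      by (intro two) auto
    show ?thesis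
    \<comment> \<open>The bound \<open>four\<close> needs a position strictly between
      \<open>i\<close> and \<open>j\<close>. This is \<open>a\<close> unless \<open>a = i\<close>,
      and then it is \<open>a + 2\<close>, as \<open>i + 3 \<le> j\<close>.\<close>
    proof (cases "i < a")
      case True
      then show ?thesis
        using that[of "a + 1" a] 2 four[of a] a ij' step[of a] sym by auto
    next
      case False
      then show ?thesis
        using that[of "a + 1" "a + 2"] 2 four[of "a + 2"] a ij' step[of "a + 1"] by auto
    qed
  next
    case False
    \<comment> \<open>Without chords of length two, every position strictly between has only its
      neighbours on the cycle.\<close>
    have *: "{s. s < n \<and> D t s} \<subseteq> {t - 1, t + 1}" if "i < t" "t < j" for t
    proof
      fix s assume s: "s \<in> {s. s < n \<and> D t s}"
      then have "i \<le> s" "s \<le> j" "s \<le> t + 2" "t \<le> s + 2" "s \<noteq> t"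
        using nb[OF that, of s] by auto
      moreover have "D t s" "D s t"
        using s sym by auto
      then have "s \<noteq> t + 2" "t \<noteq> s + 2"
        using False that calculation by auto
      ultimately show "s \<in> {t - 1, t + 1}"
        by force
    qed
    show ?thesis
      using that[of "i + 1" "i + 2"] two[OF *, of "i + 1"] four[of "i + 2"] ij' step[of "i + 1"] by auto
  qed
qed

section \<open>Cycles and end blocks of outerplanar graphs\<close>

context outer_drawing
begin

text \<open>After a rotation the cycle meets \<open>a\<close>, \<open>b\<close>, \<open>c\<close>,
  \<open>d\<close> in this order starting at \<open>a\<close>. Splitting it at \<open>a\<close> and
  \<open>c\<close>, and again at \<open>b\<close> and \<open>d\<close>, gives the two pairs of paths
  for \<open>no_crossing_chords\<close>.\<close>

lemma cycle_chords_noncrossing: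
  assumes "graph_cycle E xs" "i < j" "j < k" "k < l" "l < length xs"
    and ac: "{xs ! i, xs ! k} \<in> E" and bd: "{xs ! j, xs ! l} \<in> E"
  shows False
proof -
  define a b c d where abcd: "a = xs ! i" "b = xs ! j" "c = xs ! k" "d = xs ! l"
  obtain X Y Z where "drop i xs = a # X @ drop j xs" "drop j xs = b # Y @ drop k xs"
    "drop k xs = c # Z @ drop l xs"
    unfolding abcd using assms(2-5) drop_nth_split[of i j xs] drop_nth_split[of j k xs] drop_nth_split[of k l xs]
    by auto
  moreover have "drop l xs = d # drop (Suc l) xs"
    using assms(5) by (simp add: Cons_nth_drop_Suc abcd)
  ultimately have "xs = take i xs @ (a # X @ b # Y @ c # Z @ d # drop (Suc l) xs)"
    by (metis append_take_drop_id)
  then have "graph_cycle E ((a # X @ b # Y @ c # Z @ d # drop (Suc l) xs) @ take i xs)"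
    using assms(1) graph_cycle_rotate by metis
  then obtain W where cyc: "graph_cycle E (a # X @ b # Y @ c # Z @ d # W)"
    by auto
  note r1 = graph_cycle_rotate[of E "a # X" "b # Y @ c # Z @ d # W", simplified, OF cyc]
  note r2 = graph_cycle_rotate[of E "a # X @ b # Y" "c # Z @ d # W", simplified, OF cyc]
  note r3 = graph_cycle_rotate[of E "a # X @ b # Y @ c # Z" "d # W", simplified, OF cyc]
  have p1: "graph_path E (a # X @ b # Y @ [c])"
    using graph_cycle_prefix[of E "a # X @ b # Y @ [c]" "Z @ d # W"] cyc by simp
  have p2: "graph_path E (b # Y @ c # Z @ [d])"
    using graph_cycle_prefix[of E "b # Y @ c # Z @ [d]" "W @ a # X"] r1 by simp
  have p3: "graph_path E (c # Z @ d # W @ [a])"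
    using graph_cycle_prefix[of E "c # Z @ d # W @ [a]" "X @ b # Y"] r2 by simp
  have p4: "graph_path E (d # W @ a # X @ [b])"
    using graph_cycle_prefix[of E "d # W @ a # X @ [b]" "Y @ c # Z"] r3 by simp
  have dist: "distinct (a # X @ b # Y @ c # Z @ d # W)"
    using cyc by (simp add: graph_cycle_def graph_path_def)
  have pe: "path_edges (u # us @ v # vs @ [w]) = path_edges (u # us @ [v]) \<union> path_edges (v # vs @ [w])"
    for u us v vs w
    using path_edges_append[of "u # us" v "vs @ [w]"] by simp
  show False
  proof (rule no_crossing_chords[of "a # X @ b # Y @ [c]" "rev (c # Z @ d # W @ [a])" a c
        "rev (d # W @ a # X @ [b])" "b # Y @ c # Z @ [d]" b d])
    show "graph_path E (a # X @ b # Y @ [c])" "graph_path E (b # Y @ c # Z @ [d])"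
      by fact+
    show "graph_path E (rev (c # Z @ d # W @ [a]))" "graph_path E (rev (d # W @ a # X @ [b]))"
      using p3 p4 by (simp_all only: graph_path_rev)
    show "path_edges (a # X @ b # Y @ [c]) \<union> path_edges (rev (c # Z @ d # W @ [a])) =
      path_edges (rev (d # W @ a # X @ [b])) \<union> path_edges (b # Y @ c # Z @ [d])"
      unfolding path_edges_rev pe by blast
    show "{a, c} \<in> E" "{b, d} \<in> E"
      using ac bd by (simp_all add: abcd)
  qed (use dist in auto)
qed

text \<open>
  A smallest such \<open>B\<close> is an end block of the graph, with \<open>r\<close> its cut vertex (any vertex, if the
  block is a whole component).
\<close>

definition end_block :: "'a set \<Rightarrow> 'a \<Rightarrow> bool" where
  "end_block B r \<longleftrightarrow> B \<subseteq> V \<and> r \<in> B \<and> card B \<ge> 2 \<and> (\<forall>v\<in>B - {r}. \<forall>u. {v, u} \<in> E \<longrightarrow> u \<in> B)"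

text \<open>A smallest end block has no cut vertex. Let \<open>S\<close> be the part of
  \<open>B - {c}\<close> reachable from \<open>u\<close>. If \<open>r\<close> is not in
  \<open>S\<close>, then \<open>S\<close> with root \<open>c\<close> added is an end block, hence
  all of \<open>B\<close>. If \<open>r\<close> is in \<open>S\<close> and something else is left,
  then \<open>B - S\<close> with root \<open>c\<close> is a smaller end block.\<close>

lemma end_block_connected:
  assumes fin: "finite V" and B: "end_block B r"
    and minimal: "\<forall>B' r'. end_block B' r' \<longrightarrow> card B \<le> card B'"
    and "c \<in> B" "u \<in> B - {c}" "v \<in> B - {c}"
  shows "(\<lambda>x y. {x, y} \<in> E \<and> y \<in> B - {c})\<^sup>*\<^sup>* u v"
proof -
  define S where "S = {v. (\<lambda>x y. {x, y} \<in> E \<and> y \<in> B - {c})\<^sup>*\<^sup>* u v}"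
  have finB: "finite B"
    using B fin finite_subset by (auto simp: end_block_def)
  have "u \<in> S"
    by (simp add: S_def)
  have "y \<in> B - {c}" if "y \<in> S" for y
  proof -
    have "(\<lambda>x y. {x, y} \<in> E \<and> y \<in> B - {c})\<^sup>*\<^sup>* u y"
      using that by (simp add: S_def)
    then show ?thesis
      by (induction) (use assms(5) in auto)
  qed
  then have SB: "S \<subseteq> B - {c}"
    by blast
  have closed: "y \<in> S" if "x \<in> S" "{x, y} \<in> E" "y \<in> B - {c}" for x y
    using that unfolding S_def by (auto intro: rtranclp.rtrancl_into_rtrancl)
  have "S = B - {c}"
  proof (cases "r \<in> S")
    case False
    have "end_block (insert c S) c"
      unfolding end_block_def
    proof (intro conjI ballI allI impI)
      show "2 \<le> card (insert c S)"
      proof -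
        have "card {c, u} \<le> card (insert c S)"
          using \<open>u \<in> S\<close> SB finB finite_subset[OF SB] by (intro card_mono) auto
        then show ?thesis using assms(5) by auto
      qed
      show "y \<in> insert c S" if "x \<in> insert c S - {c}" "{x, y} \<in> E" for x y
        using that B SB False closed[of x y] unfolding end_block_def by blast
    qed (use SB B assms(4) in \<open>auto simp: end_block_def\<close>)
    then have "insert c S = B"
      using minimal SB assms(4) finB by (intro card_seteq) blast+
    then show ?thesis using SB by blast
  next
    case True
    show ?thesis
    proof (rule ccontr)
      assume "S \<noteq> B - {c}"
      then obtain w where w: "w \<in> B - {c}" "w \<notin> S"
        using SB by blast
      have "end_block (B - S) c"
        unfolding end_block_def
      proof (intro conjI ballI allI impI)
        have "card {c, w} \<le> card (B - S)"
          using w assms(4) SB finB by (intro card_mono) auto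
        then show "2 \<le> card (B - S)" using w by auto
        show "y \<in> B - S" if "x \<in> B - S - {c}" "{x, y} \<in> E" for x y
          using that B SB True closed[of y x] unfolding end_block_def by (auto simp: insert_commute)
      qed (use SB B assms(4) in \<open>auto simp: end_block_def\<close>)
      then have "card B \<le> card (B - S)"
        using minimal by blast
      moreover have "card (B - S) < card B"
        using \<open>u \<in> S\<close> SB finB by (intro psubset_card_mono) auto
      ultimately show False by simp
    qed
  qed
  then show ?thesis
    using assms(6) by (auto simp: S_def)
qed

text \<open>By \<open>no_theta\<close> the ends of an ear are consecutive on the cycle, so the ear
  can replace the edge between them.\<close>

lemma ear_of_cycle:
  assumes "graph_cycle E (c # as @ y # bs)" "graph_path E (c # zs @ [y])" "zs \<noteq> []"
    and "set zs \<inter> set (c # as @ y # bs) = {}"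
  obtains ws where "graph_cycle E ws" "set ws = set (c # as @ y # bs) \<union> set zs"
    "length ws > length (c # as @ y # bs)"
proof -
  have ext: "\<exists>ws. graph_cycle E ws \<and> set ws = set (c # y # us) \<union> set zs \<and> length ws > length (c # y # us)"
    if "graph_cycle E (c # y # us)" "set zs \<inter> set (c # y # us) = {}" for us
  proof (intro exI[of _ "c # zs @ y # us"] conjI)
    have us: "us \<noteq> []" "graph_path E (y # us)" "c \<notin> set (y # us)"
      using that(1) by (auto simp: graph_cycle_def graph_path_Cons)
    have cz: "graph_path E ((c # zs) @ [y])"
      using assms(2) by simp
    then have "graph_path E (c # zs)" "{last (c # zs), y} \<in> E"
      using graph_path_append[of "c # zs" "[y]" E] by simp_all
    then have "graph_path E ((c # zs) @ (y # us))"
      using us that(2) by (subst graph_path_append) auto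
    then show "graph_cycle E (c # zs @ y # us)"
      using that(1) us by (auto simp: graph_cycle_def)
  qed (use assms(3) in auto)
  \<comment> \<open>Either \<open>y\<close> follows \<open>c\<close>, or it precedes
    \<open>c\<close> cyclically and reversal reduces this to the first case, or both segments of the
    cycle between them have inner vertices and form a theta with the ear.\<close>
  consider "as = []" | "bs = []" | "as \<noteq> []" "bs \<noteq> []" by blast
  then show ?thesis
  proof cases
    case 1
    then show ?thesis using ext[of bs] assms that by auto
  next
    case 2
    have "graph_cycle E (rev ((as @ [y]) @ [c]))"
      unfolding graph_cycle_rev using graph_cycle_rotate[of E "[c]" "as @ [y]"] assms(1) 2 by simp
    then have "graph_cycle E (c # y # rev as)" by simp
    then show ?thesis using ext[of "rev as"] assms that 2 by auto
  next
    case 3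
    have dist: "distinct (c # as @ y # bs)"
      using assms(1) by (simp add: graph_cycle_def graph_path_def)
    have "graph_path E (c # as @ [y])"
      using graph_cycle_prefix[of E "c # as @ [y]" bs] assms(1) by simp
    moreover have "graph_cycle E ((y # bs @ [c]) @ as)"
      using graph_cycle_rotate[of E "c # as" "y # bs"] assms(1) by simp
    then have "graph_path E (rev (y # bs @ [c]))"
      unfolding graph_path_rev by (rule graph_cycle_prefix) simp
    then have "graph_path E (c # rev bs @ [y])" by simp
    ultimately have False
      using no_theta[of c as y zs "rev bs"] assms 3 dist by auto
    then show ?thesis ..
  qed
qed

text \<open>A longest cycle within the block spans it: from a vertex off the cycle, connectedness
  after deleting a vertex produces an ear and thus a longer cycle.\<close>

lemma end_block_hamiltonian:
  assumes fin: "finite V" and B: "end_block B r"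
    and minimal: "\<forall>B' r'. end_block B' r' \<longrightarrow> card B \<le> card B'"
    and deg: "\<forall>v\<in>V. degree E v \<ge> 2"
  obtains xs where "graph_cycle E xs" "set xs = B" "hd xs = r"
proof -
  note conn = end_block_connected[OF fin B minimal]
  have finB: "finite B" and BV: "B \<subseteq> V" and rB: "r \<in> B"
    using B fin finite_subset by (auto simp: end_block_def)
  define P where "P xs \<longleftrightarrow> graph_cycle E xs \<and> set xs \<subseteq> B" for xs
  have len: "length xs \<le> card B" if "P xs" for xs
  proof -
    have "length xs = card (set xs)"
      using that by (simp add: P_def graph_cycle_def graph_path_def distinct_card)
    also have "\<dots> \<le> card B"
      using that finB by (auto simp: P_def intro: card_mono)
    finally show ?thesis .
  qed
  have "B - {r} \<noteq> {}"
  proof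
    assume "B - {r} = {}"
    then have "card B \<le> card {r}" by (intro card_mono) auto
    then show False using B by (simp add: end_block_def)
  qed
  then obtain v where v: "v \<in> B - {r}" by blast
  \<comment> \<open>A first cycle: \<open>v\<close> is not the root, so its two neighbours lie in
    \<open>B\<close>, where a path avoiding \<open>v\<close> joins them.\<close>
  have "\<exists>a b. a \<noteq> b \<and> {v, a} \<in> E \<and> {v, b} \<in> E"
  proof (rule ccontr)
    assume "\<not> ?thesis"
    then obtain a where "\<And>u. {v, u} \<in> E \<Longrightarrow> u \<in> {a}" by blast
    then have "degree E v \<le> card {a}"
      using simple by (intro degree_le) (auto simp: simple_graph_def)
    then show False using deg v BV by force
  qed
  then obtain a b where ab: "a \<noteq> b" "{v, a} \<in> E" "{v, b} \<in> E" by blast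
  then have "a \<in> B - {v}" "b \<in> B - {v}"
    using B v edge_neq by (auto simp: end_block_def)
  then have "(\<lambda>x y. {x, y} \<in> E \<and> y \<in> B - {v})\<^sup>*\<^sup>* a b"
    using conn[of v a b] v by blast
  from reachable_path[OF this \<open>a \<in> B - {v}\<close>, of "{b}"] obtain ys
    where ys: "graph_path E (ys @ [b])" "hd (ys @ [b]) = a" "set (ys @ [b]) \<subseteq> B - {v}" by blast
  have "ys \<noteq> []" using ys ab by auto
  moreover have "graph_path E ([v] @ (ys @ [b]))"
    using ys ab by (subst graph_path_append) auto
  ultimately have "P (v # ys @ [b])"
    using ys ab v by (cases ys) (auto simp: P_def graph_cycle_def insert_commute)
  then obtain xs where xs: "P xs" and longest: "\<And>zs. P zs \<Longrightarrow> length zs \<le> length xs"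
    using ex_has_greatest_nat[of P "v # ys @ [b]" length "Suc (card B)"] len by (metis less_Suc_eq_le)
  have cyc: "graph_cycle E xs" and sub: "set xs \<subseteq> B" and dist: "distinct xs" and l3: "length xs \<ge> 3"
    using xs by (auto simp: P_def graph_cycle_def graph_path_def)
  have other: "\<exists>t. t \<in> set xs - {c}" for c
  proof (rule ccontr)
    assume "\<not> ?thesis"
    then have "card (set xs) \<le> card {c}" by (intro card_mono) auto
    then show False using dist l3 by (simp add: distinct_card)
  qed
  have "set xs = B"
  proof (rule ccontr)
    assume "set xs \<noteq> B"
    then obtain u where u: "u \<in> B" "u \<notin> set xs" using sub by blast
    \<comment> \<open>Connectedness is available only after deleting a vertex; \<open>c0\<close> is
      deleted just to reach the cycle from \<open>u\<close>, at some vertex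
      \<open>c\<close>.\<close>
    define c0 where "c0 = hd xs"
    have c0: "c0 \<in> set xs" using l3 unfolding c0_def by (cases xs) auto
    obtain t where "t \<in> set xs - {c0}" using other by blast
    then have "(\<lambda>x y. {x, y} \<in> E \<and> y \<in> B - {c0})\<^sup>*\<^sup>* u t"
      using conn[of c0 u t] sub c0 u by blast
    from reachable_path[OF this, of "set xs"] obtain ys c
      where ys: "graph_path E (ys @ [c])" "hd (ys @ [c]) = u" "c \<in> set xs" "set ys \<inter> set xs = {}"
        "set (ys @ [c]) \<subseteq> B"
      using u c0 \<open>t \<in> set xs - {c0}\<close> by blast
    have "ys \<noteq> []" using ys u by auto
    \<comment> \<open>\<open>w\<close> is off the cycle and adjacent to \<open>c\<close>. A second
      path from \<open>w\<close> to the cycle, now avoiding \<open>c\<close>, completes an ear with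
      distinct ends \<open>c\<close> and \<open>y\<close>.\<close>
    define w where "w = last ys"
    have "w \<in> set ys"
      using \<open>ys \<noteq> []\<close> by (simp add: w_def)
    then have w: "w \<in> B" "w \<notin> set xs" "{w, c} \<in> E"
      using ys(1,4,5) graph_path_append[OF \<open>ys \<noteq> []\<close>, of "[c]" E] by (auto simp: w_def)
    obtain t' where t': "t' \<in> set xs - {c}" using other by blast
    then have "(\<lambda>x y. {x, y} \<in> E \<and> y \<in> B - {c})\<^sup>*\<^sup>* w t'"
      using conn[of c w t'] sub ys(3) w by blast
    from reachable_path[OF this, of "set xs - {c}"] obtain zs y
      where zs: "graph_path E (zs @ [y])" "hd (zs @ [y]) = w" "y \<in> set xs - {c}"
        "set zs \<inter> (set xs - {c}) = {}" "set (zs @ [y]) \<subseteq> B - {c}"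
      using w ys(3) t' by blast
    have "zs \<noteq> []" using zs w by auto
    have ear: "graph_path E ([c] @ (zs @ [y]))"
      using zs w by (subst graph_path_append) (auto simp: insert_commute)
    obtain us vs where "xs = us @ c # vs" using ys(3) by (meson split_list)
    then have rot: "graph_cycle E (c # vs @ us)" "set (c # vs @ us) = set xs" "length (c # vs @ us) = length xs"
      using graph_cycle_rotate[of E us "c # vs"] cyc by auto
    then have "y \<in> set (vs @ us)" using zs(3) by auto
    then obtain as bs where asbs: "vs @ us = as @ y # bs" by (meson split_list)
    obtain ws where "graph_cycle E ws" "set ws = set (c # as @ y # bs) \<union> set zs"
      "length ws > length (c # as @ y # bs)"
      by (rule ear_of_cycle[of c as y bs zs]) (use ear rot zs \<open>zs \<noteq> []\<close> asbs in auto)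
    then have "P ws" "length ws > length xs"
      using rot asbs zs sub by (auto simp: P_def)
    then show False using longest by fastforce
  qed
  then obtain us vs where "xs = us @ r # vs"
    using rB by (metis split_list)
  then show ?thesis
    using that[of "r # vs @ us"] graph_cycle_rotate[of E us "r # vs"] cyc \<open>set xs = B\<close> by auto
qed

text \<open>Only the root of an end block can have edges leaving it. The spanning cycle has the root
  at position 0, which \<open>noncrossing_chords_light\<close> avoids, so counting neighbours on the
  cycle bounds the degree in the whole graph.\<close>

lemma light_edge:
  assumes fin: "finite V" and "V \<noteq> {}" and deg: "\<forall>v\<in>V. degree E v \<ge> 2"
  obtains u w where "{u, w} \<in> E" "degree E u \<le> 2" "degree E w \<le> 4"
proof -
  have card2: "\<And>e. e \<in> E \<Longrightarrow> card e = 2"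
    using simple by (simp add: simple_graph_def)
  obtain v where v: "v \<in> V" using assms(2) by blast
  \<comment> \<open>The whole vertex set with any root qualifies, so a smallest end block
    exists.\<close>
  have "end_block V v"
  proof -
    have "{e \<in> E. v \<in> e} \<noteq> {}"
      using deg v unfolding degree_def by (metis card.empty not_numeral_le_zero)
    then obtain e where "e \<in> E" by blast
    then have "card V \<ge> 2"
      using card2[of e] card_mono[OF fin edge_subset] by force
    moreover have "u \<in> V" if "{w, u} \<in> E" for w u
      using edge_subset[OF that] by simp
    ultimately show ?thesis
      using v by (auto simp: end_block_def)
  qed
  then obtain B r where B: "end_block B r" and "\<forall>B' r'. end_block B' r' \<longrightarrow> card B \<le> card B'"
    using ex_has_least_nat[of "\<lambda>(B, r). end_block B r" "(V, v)" "\<lambda>(B, r). card B"] by auto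
  from end_block_hamiltonian[OF fin this deg] obtain xs
    where xs: "graph_cycle E xs" "set xs = B" "hd xs = r" by blast
  define n where "n = length xs"
  have path: "graph_path E xs" and n: "n \<ge> 3" and dist: "distinct xs" and wrap: "{xs ! 0, xs ! (n - 1)} \<in> E"
    using xs(1) by (auto simp: graph_cycle_def graph_path_def n_def hd_conv_nth last_conv_nth insert_commute)
  have r: "xs ! 0 = r"
    using xs(3) n by (simp add: n_def hd_conv_nth[symmetric] flip: length_greater_0_conv)
  obtain t t' where t: "0 < t" "t < n" "0 < t'" "t' < n" "{xs ! t, xs ! t'} \<in> E"
    "card {s. s < n \<and> {xs ! t, xs ! s} \<in> E} \<le> 2" "card {s. s < n \<and> {xs ! t', xs ! s} \<in> E} \<le> 4"
  proof (rule noncrossing_chords_light[of n "\<lambda>s t. {xs ! s, xs ! t} \<in> E"])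
    show "{xs ! s, xs ! Suc s} \<in> E" if "Suc s < n" for s
      using graph_path_nth[OF path] that by (simp add: n_def)
    show False if "i < j" "j < k" "k < l" "l < n" "{xs ! i, xs ! k} \<in> E" "{xs ! j, xs ! l} \<in> E" for i j k l
      using cycle_chords_noncrossing[OF xs(1)] that by (auto simp: n_def)
    show "{xs ! s, xs ! s} \<notin> E" for s
      using edge_neq by blast
  qed (use n wrap in \<open>auto simp: insert_commute\<close>)
  have le: "degree E (xs ! q) \<le> card {s. s < n \<and> {xs ! q, xs ! s} \<in> E}" if "0 < q" "q < n" for q
  proof -
    have "0 < length xs"
      using n unfolding n_def by linarith
    then have "xs ! q \<noteq> xs ! 0"
      using that nth_eq_iff_index_eq[OF dist, of q 0] unfolding n_def by blast
    then have "xs ! q \<in> B - {r}"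
      using that xs(2) r by (auto simp: n_def)
    then have "u \<in> set xs" if "{xs ! q, u} \<in> E" for u
      using B that xs(2) unfolding end_block_def by blast
    then have "u \<in> (!) xs ` {s. s < n \<and> {xs ! q, xs ! s} \<in> E}" if "{xs ! q, u} \<in> E" for u
      using that unfolding n_def in_set_conv_nth by blast
    then have "degree E (xs ! q) \<le> card ((!) xs ` {s. s < n \<and> {xs ! q, xs ! s} \<in> E})"
      by (intro degree_le card2) simp_all
    also have "\<dots> \<le> card {s. s < n \<and> {xs ! q, xs ! s} \<in> E}"
      by (intro card_image_le) simp
    finally show ?thesis .
  qed
  show ?thesis
    using that[OF t(5)] le[OF t(1,2)] le[OF t(3,4)] t(6,7) by linarith
qed

end

section \<open>Orders of the total graph\<close>

text \<open>The condition from \<open>coloring_number\<close> without the set to be enumerated, so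
  that partial orders can be extended.\<close>

definition degenerate_order :: "'b set set \<Rightarrow> nat \<Rightarrow> 'b list \<Rightarrow> bool" where
  "degenerate_order T m xs \<longleftrightarrow> distinct xs \<and>
    (\<forall>i<length xs. card {u \<in> set (take i xs). {u, xs ! i} \<in> T} < m)"

lemma degenerate_order_snoc:
  assumes "degenerate_order T m xs" "x \<notin> set xs" "card {u \<in> set xs. {u, x} \<in> T} < m"
  shows "degenerate_order T m (xs @ [x])"
  using assms by (auto simp: degenerate_order_def nth_append less_Suc_eq)

lemma coloring_number_le:
  "degenerate_order T m xs \<Longrightarrow> set xs = X \<Longrightarrow> coloring_number X T \<le> m"
  unfolding coloring_number_def degenerate_order_def by (rule Least_le) blast

text \<open>Erasing parts of the drawing enlarges its outside. A remaining vertex stays in the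
  closure of the outside and, being drawn, is not in its interior.\<close>

lemma outer_drawing_subgraph:
  assumes "outer_drawing V E p g" "V' \<subseteq> V" "E' \<subseteq> E" "\<And>e. e \<in> E' \<Longrightarrow> e \<subseteq> V'"
  shows "outer_drawing V' E' p g"
proof
  interpret outer_drawing V E p g by fact
  show "simple_graph V' E'"
    using simple assms(3,4) by (auto simp: simple_graph_def)
  show "plane_drawing V' E' p g"
    unfolding plane_drawing_def
  proof (intro conjI ballI impI)
    show "inj_on p V'"
      using inj_p assms(2) by (rule inj_on_subset)
    fix e assume "e \<in> E'"
    then have e: "e \<in> E" "e \<subseteq> V'"
      using assms(3,4) by auto
    then show "arc (g e)" "{pathstart (g e), pathfinish (g e)} = p ` e"
      using drawing by (simp_all add: plane_drawing_def)
    have "path_image (g e) \<inter> p ` V = p ` e"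
      using drawing e(1) by (simp add: plane_drawing_def)
    then show "path_image (g e) \<inter> p ` V' = p ` e"
      using assms(2) e(2) by blast
    fix f assume "f \<in> E'" "e \<noteq> f"
    then show "path_image (g e) \<inter> path_image (g f) = p ` (e \<inter> f)"
      using e(1) assms(3) by (intro edge_inter) auto
  qed
  fix v assume v: "v \<in> V'"
  let ?D = "drawn_points V E p g" and ?D' = "drawn_points V' E' p g"
  have "?D' \<subseteq> ?D"
    using assms(2,3) by (auto simp: drawn_points_def)
  moreover have "p v \<in> closure (outside ?D)"
    using outer assms(2) v by (auto simp: frontier_def)
  ultimately have "p v \<in> closure (outside ?D')"
    using closure_mono[OF outside_mono] by blast
  moreover have "p v \<in> ?D'"
    using v by (simp add: drawn_points_def)
  then have "p v \<notin> interior (outside ?D')"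
    using interior_subset[of "outside ?D'"] outside_no_overlap[of ?D'] by blast
  ultimately show "p v \<in> frontier (outside ?D')"
    by (simp add: frontier_def)
qed

section \<open>Neighbourhoods in the total graph\<close>

lemma total_edges_Inr_Inr:
  "{Inr e, Inr f} \<in> total_edges V E \<longleftrightarrow> e \<in> E \<and> f \<in> E \<and> e \<noteq> f \<and> e \<inter> f \<noteq> {}"
  by (auto simp: total_edges_def doubleton_eq_iff)

lemma total_edges_Inl_Inr:
  "{Inl v, Inr e} \<in> total_edges V E \<longleftrightarrow> v \<in> V \<and> e \<in> E \<and> v \<in> e"
  by (auto simp: total_edges_def doubleton_eq_iff)

lemma total_edges_Inl_Inl:
  "{Inl u, Inl v} \<in> total_edges V E \<longleftrightarrow> u \<in> V \<and> v \<in> V \<and> {u, v} \<in> E"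
  by (auto simp: total_edges_def doubleton_eq_iff insert_commute)

lemmas total_edges_iff = total_edges_Inl_Inl total_edges_Inl_Inr total_edges_Inr_Inr
  total_edges_Inl_Inr[unfolded insert_commute[of "Inl _" "Inr _"]]

text \<open>\<open>S\<close> holds the elements placed earlier, without \<open>u\<close>. The edge
  sees \<open>w\<close>, the placed edges at \<open>u\<close> and the other edges at
  \<open>w\<close>; counting \<open>w\<close> makes up for leaving out \<open>{u, w}\<close> itself
  among the edges at \<open>w\<close>.\<close>

lemma card_total_neighbours_edge:
  assumes "finite E'" "E' \<subseteq> E" "Inl u \<notin> S" "\<And>e. Inr e \<in> S \<Longrightarrow> e \<in> E'" "Inr {u, w} \<notin> S" "{u, w} \<in> E'"
  shows "card {z \<in> S. {z, Inr {u, w}} \<in> total_edges V E} \<le> card {e. Inr e \<in> S \<and> u \<in> e} + degree E' w"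
proof -
  let ?F = "{e. Inr e \<in> S \<and> u \<in> e}" and ?G = "{e \<in> E'. w \<in> e}"
  have "?F \<subseteq> E'"
    using assms(4) by blast
  then have fin: "finite ?F" "finite ?G"
    using assms(1) finite_subset by auto
  have "{z \<in> S. {z, Inr {u, w}} \<in> total_edges V E} \<subseteq> insert (Inl w) (Inr ` (?F \<union> (?G - {{u, w}})))"
  proof
    fix z assume "z \<in> {z \<in> S. {z, Inr {u, w}} \<in> total_edges V E}"
    then show "z \<in> insert (Inl w) (Inr ` (?F \<union> (?G - {{u, w}})))"
      using assms(3-5) by (cases z) (auto simp: total_edges_iff)
  qed
  then have "card {z \<in> S. {z, Inr {u, w}} \<in> total_edges V E} \<le>
      card (insert (Inl w) (Inr ` (?F \<union> (?G - {{u, w}}))))"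
    using fin by (intro card_mono) auto
  also have "\<dots> = Suc (card (?F \<union> (?G - {{u, w}})))"
    using fin by (subst card_insert_disjoint) (auto simp: card_image)
  also have "\<dots> \<le> Suc (card ?F + card (?G - {{u, w}}))"
    by (simp add: card_Un_le)
  also have "\<dots> = card ?F + card ?G"
    using fin assms(6) card_Suc_Diff1[of ?G "{u, w}"] by simp
  finally show ?thesis by (simp add: degree_def)
qed

text \<open>Each edge at \<open>u\<close> accounts for itself and for its other end.\<close>

lemma card_total_neighbours_vertex:
  assumes "finite E'" "Inl u \<notin> S" "\<And>e. Inr e \<in> S \<Longrightarrow> u \<in> e \<Longrightarrow> e \<in> E'"
    and "\<And>w. Inl w \<in> S \<Longrightarrow> {u, w} \<in> E \<Longrightarrow> {u, w} \<in> E'"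
  shows "card {z \<in> S. {z, Inl u} \<in> total_edges V E} \<le> 2 * degree E' u"
proof -
  let ?F = "{e \<in> E'. u \<in> e}" and ?N = "{w. {u, w} \<in> E'}"
  have fin: "finite ?F"
    using assms(1) by simp
  have inj: "inj_on (\<lambda>w. {u, w}) ?N"
    by (auto simp: inj_on_def doubleton_eq_iff)
  have "(\<lambda>w. {u, w}) ` ?N \<subseteq> ?F"
    by auto
  then have N: "finite ?N" "card ?N \<le> card ?F"
    using card_inj_on_le[OF inj _ fin] inj_on_finite[OF inj _ fin] by auto
  have "{z \<in> S. {z, Inl u} \<in> total_edges V E} \<subseteq> Inl ` ?N \<union> Inr ` ?F"
  proof
    fix z assume "z \<in> {z \<in> S. {z, Inl u} \<in> total_edges V E}"
    then show "z \<in> Inl ` ?N \<union> Inr ` ?F"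
      using assms(2-4) by (cases z) (auto simp: total_edges_iff insert_commute)
  qed
  then have "card {z \<in> S. {z, Inl u} \<in> total_edges V E} \<le> card (Inl ` ?N \<union> Inr ` ?F)"
    using fin N by (intro card_mono) auto
  also have "\<dots> \<le> card ?N + card ?F"
    using card_Un_le[of "Inl ` ?N" "Inr ` ?F"] by (simp add: card_image)
  finally show ?thesis
    using N(2) by (simp add: degree_def)
qed

text \<open>The induction runs over vertex sets \<open>V'\<close> while adjacency stays that of the
  whole total graph, so the order for \<open>V' - {u}\<close> can be kept as a prefix.\<close>

lemma total_degenerate_order:
  fixes V :: "'a set"
  assumes od: "outer_drawing V E p g" and fin: "finite V" and k: "k \<ge> 5" and deg: "\<forall>v\<in>V. degree E v \<le> k"
    and "V' \<subseteq> V"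
  shows "\<exists>xs. degenerate_order (total_edges V E) (k + 1) xs \<and> set xs = V' <+> {e \<in> E. e \<subseteq> V'}"
  using finite_subset[OF assms(5) fin] assms(5)
proof (induction V' rule: finite_psubset_induct)
  case (psubset V')
  let ?T = "total_edges V E"
  define E' where "E' = {e \<in> E. e \<subseteq> V'}"
  interpret outer_drawing V' E' p g
    by (rule outer_drawing_subgraph[OF od psubset.prems]) (auto simp: E'_def)
  have finE: "finite E"
    using od fin finite_subset[of E "Pow V"] by (auto simp: outer_drawing_def simple_graph_def)
  then have finE': "finite E'"
    by (simp add: E'_def)
  have card2: "card e = 2" if "e \<in> E'" for e
    using simple that by (simp add: simple_graph_def)
  have deg': "degree E' v \<le> k" if "v \<in> V'" for v
  proof -
    have "degree E' v \<le> degree E v"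
      unfolding degree_def using finE by (intro card_mono) (auto simp: E'_def)
    then show ?thesis
      using deg that psubset.prems by fastforce
  qed
  show ?case
  proof (cases "V' = {}")
    case True
    then have "E' = {}"
      using card2 by (fastforce simp: E'_def)
    then show ?thesis
      using True by (intro exI[of _ "[]"]) (auto simp: degenerate_order_def E'_def)
  next
    case False
    \<comment> \<open>\<open>es\<close> lists the edges at \<open>u\<close> in the order of
      insertion. If there are two, the last one needs a far end of degree at most 4; with fewer,
      \<open>light\<close> is vacuous.\<close>
    obtain u es where u: "u \<in> V'" and es: "{e \<in> E'. u \<in> e} = set es" "distinct es" "length es \<le> 2"
      and light: "\<And>e w. es = [e, {u, w}] \<Longrightarrow> degree E' w \<le> 4"
    proof (cases "\<forall>v\<in>V'. degree E' v \<ge> 2")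
      case True
      obtain u w where uw: "{u, w} \<in> E'" "degree E' u \<le> 2" "degree E' w \<le> 4"
        using light_edge[OF finite_subset[OF psubset.prems fin] False True] by blast
      then have u: "u \<in> V'" "degree E' u = 2"
        using edge_subset[OF uw(1)] True by force+
      then have "card ({e \<in> E'. u \<in> e} - {{u, w}}) = 1"
        using uw finE' by (simp add: degree_def)
      then obtain e where e: "{e \<in> E'. u \<in> e} - {{u, w}} = {e}"
        by (auto simp: card_1_singleton_iff)
      have "{u, w} \<in> {e \<in> E'. u \<in> e}"
        using uw(1) by simp
      with e have "{e \<in> E'. u \<in> e} = set [e, {u, w}]" "e \<noteq> {u, w}"
        unfolding list.set by blast+
      moreover have "degree E' w' \<le> 4" if "[e, {u, w}] = [e', {u, w'}]" for e' w'
        using that uw(3) by (auto simp: doubleton_eq_iff)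
      ultimately show ?thesis
        using that[of u "[e, {u, w}]"] u(1) by simp
    next
      case False
      then obtain u where u: "u \<in> V'" "degree E' u < 2"
        by force
      obtain es where "set es = {e \<in> E'. u \<in> e}" "distinct es"
        using finite_distinct_list[of "{e \<in> E'. u \<in> e}"] finE' by auto
      moreover from this have "length es < 2"
        using u(2) distinct_card[of es] by (simp add: degree_def)
      moreover from this have "es \<noteq> [e, f]" for e f
        by auto
      ultimately show ?thesis
        using that[of u es] u(1) by simp
    qed
    have other: "\<exists>w. e = {u, w} \<and> w \<in> V'" if "e \<in> set es" for e
    proof -
      have e: "e \<in> E'" "u \<in> e"
        using that es(1) by auto
      then obtain x y where "e = {x, y}"
        using card2[OF e(1)] by (auto simp: card_2_iff)
      then show ?thesis
        using e by (auto simp: E'_def)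
    qed
    define E0 where "E0 = {e \<in> E. e \<subseteq> V' - {u}}"
    have E0: "E' = E0 \<union> set es" "E0 \<inter> set es = {}" "\<And>e. e \<in> E0 \<Longrightarrow> u \<notin> e"
      using es(1) by (auto simp: E0_def E'_def)
    obtain xs where xs: "degenerate_order ?T (k + 1) xs" "set xs = (V' - {u}) <+> E0"
      using psubset.IH[of "V' - {u}"] psubset.prems u by (auto simp: E0_def)
    \<comment> \<open>\<open>G\<close> is the set of edges at \<open>u\<close> that are already
      placed.\<close>
    have addedge: "degenerate_order ?T (k + 1) (ys @ [Inr {u, w}])"
      if "degenerate_order ?T (k + 1) ys" "set ys = (V' - {u}) <+> (E0 \<union> G)" "G \<subseteq> set es"
        "{u, w} \<in> set es - G" "card G + degree E' w \<le> k" for ys w G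
    proof (rule degenerate_order_snoc[OF that(1)])
      have "{e. Inr e \<in> set ys \<and> u \<in> e} = G"
        using that(2,3) es(1) E0(3) by auto
      moreover show new: "Inr {u, w} \<notin> set ys"
        using that(2,4) E0 by auto
      moreover have "card {z \<in> set ys. {z, Inr {u, w}} \<in> ?T} \<le>
          card {e. Inr e \<in> set ys \<and> u \<in> e} + degree E' w"
        using that(2-4) E0 finE' new by (intro card_total_neighbours_edge) (auto simp: E'_def)
      ultimately show "card {z \<in> set ys. {z, Inr {u, w}} \<in> ?T} < k + 1"
        using that(5) by simp
    qed
    have "degenerate_order ?T (k + 1) (xs @ map Inr es)"
    proof -
      consider "es = []" | e where "es = [e]" | e f where "es = [e, f]"
        using es(3) by (cases es rule: path_edges.cases) auto
      then show ?thesis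
      proof cases
        case 1
        then show ?thesis using xs by simp
      next
        case (2 e)
        then obtain w where "e = {u, w}" "w \<in> V'" using other by auto
        then show ?thesis using addedge[OF xs(1), of "{}" w] xs(2) 2 deg' by auto
      next
        case (3 e f)
        obtain w w' where w: "e = {u, w}" "w \<in> V'" "f = {u, w'}" "w' \<in> V'"
          using other[of e] other[of f] 3 by auto
        have "degenerate_order ?T (k + 1) (xs @ [Inr e])"
          using addedge[OF xs(1), of "{}" w] xs(2) 3 w deg' by auto
        then have "degenerate_order ?T (k + 1) ((xs @ [Inr e]) @ [Inr {u, w'}])"
          using xs(2) 3 w es(2) light[of e w'] k by (intro addedge[where G = "{e}"]) auto
        then show ?thesis using 3 w by simp
      qed
    qed
    then have "degenerate_order ?T (k + 1) ((xs @ map Inr es) @ [Inl u])"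
    proof (rule degenerate_order_snoc)
      let ?S = "set (xs @ map Inr es)"
      have S: "?S = (V' - {u}) <+> E'"
        using xs(2) E0(1) by auto
      show "Inl u \<notin> ?S" using S by auto
      have "card {z \<in> ?S. {z, Inl u} \<in> ?T} \<le> 2 * degree E' u"
        unfolding S using finE' u by (intro card_total_neighbours_vertex) (auto simp: E'_def)
      also have "degree E' u \<le> 2"
        using es(3) card_length[of es] by (simp add: degree_def es(1))
      finally show "card {z \<in> ?S. {z, Inl u} \<in> ?T} < k + 1"
        using k by simp
    qed
    moreover have "set ((xs @ map Inr es) @ [Inl u]) = V' <+> E'"
      using xs(2) E0(1) u by auto
    ultimately show ?thesis
      unfolding E'_def by blast
  qed
qed

theorem theorem7:
  fixes V :: "'a set" and E :: "'a set set" and k :: nat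
  assumes "k \<ge> 5"
    and "finite V" and "simple_graph V E"
    and "outerplanar V E"
    and "max_degree V E \<le> k"
  shows "coloring_number (total_vertices V E) (total_edges V E) \<le> k + 1"
proof -
  obtain p g where "outer_drawing V E p g"
    using assms(3,4) by (auto simp: outerplanar_def outer_drawing_def)
  moreover have "\<forall>v\<in>V. degree E v \<le> k"
    using assms(2,5) by (simp add: max_degree_def)
  ultimately obtain xs where "degenerate_order (total_edges V E) (k + 1) xs"
    "set xs = V <+> {e \<in> E. e \<subseteq> V}"
    using total_degenerate_order[of V E p g k V] assms(1,2) by blast
  moreover have "{e \<in> E. e \<subseteq> V} = E"
    using assms(3) by (auto simp: simple_graph_def)
  ultimately show ?thesis
    by (intro coloring_number_le) (auto simp: total_vertices_def)
qed

end
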